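(* Let $V$ be a finite set equipped with a compositional graphoid $\mathcal{I}$, and let $j\in V$ and $S\subseteq V_{-j}$ be fixed. Then: (a) $\mathfrak{T}_j(S)$ is an interval in the poset $(2^{V_{-j}},\subseteq)$, and in particular a convex sublattice of it. (b) $\inf \mathfrak{T}_j(S)=m(j;S)$. (c) $\sup\mathfrak{T}_j(S)=S\cup E$, where $E=\{k\in V_{-j}\setminus S:\ k\perp\!\!\!\perp j\mid m(j;S)\}$. (d) The distinct neighbourhood lattices $\mathfrak{T}_j(S')$, as $S'$ varies over $2^{V_{-j}}$, partition $2^{V_{-j}}$. More precisely, if $m_S=m(j;S)$, then $\mathfrak{T}_j(S)=\mathfrak{T}_j(m_S)$, and $$2^{V_{-j}}=\biguplus\big\{\mathfrak{T}_j(m):\ m=m(j;T)\text{ for some }T\subseteq V_{-j}\big\},$$ where $\biguplus$ denotes a union of pairwise disjoint sets.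
   Context: Notation: $V_{-j}=V\setminus\{j\}$; braces of singletons are dropped and juxtaposition denotes union ($BD=B\cup D$). An independence model over $V$ is a ternary relation $A\perp\!\!\!\perp B\mid C$ on pairwise disjoint subsets $A,B,C\subseteq V$. It is a graphoid if, for all pairwise disjoint $A,B,C,D\subseteq V$: (G1) $A\perp\!\!\!\perp\emptyset\mid C$; (G2) $A\perp\!\!\!\perp B\mid C\Rightarrow B\perp\!\!\!\perp A\mid C$; (G3) $A\perp\!\!\!\perp BD\mid C\Rightarrow A\perp\!\!\!\perp B\mid C$ and $A\perp\!\!\!\perp D\mid C$; (G4) $A\perp\!\!\!\perp BD\mid C\Rightarrow A\perp\!\!\!\perp B\mid CD$; (G5) $A\perp\!\!\!\perp B\mid C$ and $A\perp\!\!\!\perp D\mid BC\Rightarrow A\perp\!\!\!\perp BD\mid C$; (G6) $A\perp\!\!\!\perp B\mid CD$ and $A\perp\!\!\!\perp C\mid BD\Rightarrow A\perp\!\!\!\perp BC\mid D$. It is a compositional graphoid if moreover (G7) $A\perp\!\!\!\perp B\mid C$ and $A\perp\!\!\!\perp D\mid C\Rightarrow A\perp\!\!\!\perp BD\mid C$. For $j\in V$ and $S\subseteq V_{-j}$, the relative Markov boundary is $m(j;S)=\bigcap\{U\subseteq S:\ j\perp\!\!\!\perp S\setminus U\mid U\}$, and the neighbourhood lattice of $j$ relative to $S$ is $\mathfrak{T}_j(S)=\{U\subseteq V_{-j}:\ m(j;U)=m(j;S)\}$. An interval in $(2^{V_{-j}},\subseteq)$ is a set of the form $[A,B]=\{U:\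 A\subseteq U\subseteq B\}$ with $A\subseteq B$. A subposet $\mathcal{C}$ is convex if $x\subset z\subset y$ with $x,y\in\mathcal{C}$ implies $z\in\mathcal{C}$. Joins and meets in $2^{V_{-j}}$ are unions and intersections. *)

theory Defs
  imports "HOL-Library.Disjoint_Sets"
begin

definition disj_subsets :: "'a set \<Rightarrow> 'a set list \<Rightarrow> bool" where
  "disj_subsets V Xs \<longleftrightarrow> (\<forall>X\<in>set Xs. X \<subseteq> V) \<and> sorted_wrt disjnt Xs"
  \<comment> \<open>As disjointness is symmetric, the second conjunct says that the entries of the list are
    pairwise disjoint; an empty set may occur repeatedly.\<close>

text \<open>
  The statement that \<open>A\<close> is independent of \<open>B\<close> given \<open>C\<close> is written \<open>I A B C\<close>. The relation \<open>I\<close>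
  is taken to be false outside the triples of pairwise disjoint subsets of \<open>V\<close>.
\<close>

locale independence_model =
  fixes V :: "'a set" and I :: "'a set \<Rightarrow> 'a set \<Rightarrow> 'a set \<Rightarrow> bool"
  assumes domain: "I A B C \<Longrightarrow> disj_subsets V [A, B, C]"

locale graphoid = independence_model +
  assumes triviality: "disj_subsets V [A, C] \<Longrightarrow> I A {} C"
    and symmetry: "disj_subsets V [A, B, C] \<Longrightarrow> I A B C \<Longrightarrow> I B A C"
    and decomposition:
      "disj_subsets V [A, B, C, D] \<Longrightarrow> I A (B \<union> D) C \<Longrightarrow> I A B C \<and> I A D C"
    and weak_union:
      "disj_subsets V [A, B, C, D] \<Longrightarrow> I A (B \<union> D) C \<Longrightarrow> I A B (C \<union> D)"
    and contraction:
      "disj_subsets V [A, B, C, D] \<Longrightarrow> I A B C \<Longrightarrow> I A D (B \<union> C) \<Longrightarrow> I A (B \<union> D) C"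
    and intersection:
      "disj_subsets V [A, B, C, D] \<Longrightarrow> I A B (C \<union> D) \<Longrightarrow> I A C (B \<union> D) \<Longrightarrow> I A (B \<union> C) D"

locale compositional_graphoid = graphoid +
  assumes composition:
    "disj_subsets V [A, B, C, D] \<Longrightarrow> I A B C \<Longrightarrow> I A D C \<Longrightarrow> I A (B \<union> D) C"

text \<open>
  In a graphoid with \<open>j \<in> V\<close> and \<open>S \<subseteq> V - {j}\<close>, the family intersected below contains \<open>S\<close> by
  triviality, so the intersection is never the one over the empty family.
\<close>

definition markov_boundary ::
  "('a set \<Rightarrow> 'a set \<Rightarrow> 'a set \<Rightarrow> bool) \<Rightarrow> 'a \<Rightarrow> 'a set \<Rightarrow> 'a set" where
  "markov_boundary I j S = \<Inter>{U. U \<subseteq> S \<and> I {j} (S - U) U}"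

definition nbhd_lattice ::
  "'a set \<Rightarrow> ('a set \<Rightarrow> 'a set \<Rightarrow> 'a set \<Rightarrow> bool) \<Rightarrow> 'a \<Rightarrow> 'a set \<Rightarrow> 'a set set" where
  "nbhd_lattice V I j S = {U. U \<subseteq> V - {j} \<and> markov_boundary I j U = markov_boundary I j S}"

text \<open>The next three notions refer to the poset \<open>(Pow W, \<subseteq>)\<close>.\<close>

definition interval_in_Pow :: "'a set \<Rightarrow> 'a set set \<Rightarrow> bool" where
  "interval_in_Pow W \<C> \<longleftrightarrow> (\<exists>A B. A \<subseteq> B \<and> B \<subseteq> W \<and> \<C> = {A..B})"

definition convex_in_Pow :: "'a set \<Rightarrow> 'a set set \<Rightarrow> bool" where
  "convex_in_Pow W \<C> \<longleftrightarrow>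
    \<C> \<subseteq> Pow W \<and> (\<forall>x\<in>\<C>. \<forall>y\<in>\<C>. \<forall>z\<in>Pow W. x \<subset> z \<and> z \<subset> y \<longrightarrow> z \<in> \<C>)"

definition sublattice_of_Pow :: "'a set \<Rightarrow> 'a set set \<Rightarrow> bool" where
  "sublattice_of_Pow W \<C> \<longleftrightarrow>
    \<C> \<noteq> {} \<and> \<C> \<subseteq> Pow W \<and> (\<forall>x\<in>\<C>. \<forall>y\<in>\<C>. x \<union> y \<in> \<C> \<and> x \<inter> y \<in> \<C>)"

end

theory Submission
  imports Defs
begin

text \<open>
  The blankets \<open>U \<subseteq> S\<close> of \<open>j\<close> in \<open>S\<close>, i.e. those with \<open>I {j} (S - U) U\<close>, are closed under
  intersection, so the Markov boundary \<open>m\<close> of \<open>S\<close> is itself a blanket. By contraction \<open>m\<close> is its own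
  Markov boundary, and by decomposition a set \<open>T\<close> has Markov boundary \<open>m\<close> iff \<open>m \<subseteq> T\<close> and
  \<open>I {j} (T - m) m\<close>. Composition makes the last condition pointwise in \<open>T - m\<close>, which
  turns the neighbourhood lattice into an interval.
\<close>

lemma disj_subsets_3:
  "disj_subsets V [A, B, C] \<longleftrightarrow>
    A \<subseteq> V \<and> B \<subseteq> V \<and> C \<subseteq> V \<and> A \<inter> B = {} \<and> A \<inter> C = {} \<and> B \<inter> C = {}"
  by (auto simp: disj_subsets_def disjnt_def)

lemma disj_subsets_4:
  "disj_subsets V [A, B, C, D] \<longleftrightarrow>
    disj_subsets V [A, B, C] \<and> D \<subseteq> V \<and> A \<inter> D = {} \<and> B \<inter> D = {} \<and> C \<inter> D = {}"
  by (auto simp: disj_subsets_def disjnt_def)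

lemma markov_boundary_least:
  "U \<subseteq> S \<Longrightarrow> I {j} (S - U) U \<Longrightarrow> markov_boundary I j S \<subseteq> U"
  by (auto simp: markov_boundary_def)

context graphoid
begin

lemma I_empty: "A \<subseteq> V \<Longrightarrow> C \<subseteq> V \<Longrightarrow> A \<inter> C = {} \<Longrightarrow> I A {} C"
  by (rule triviality) (auto simp: disj_subsets_def disjnt_def)

text \<open>By \<open>domain\<close>, an independence that holds already certifies the disjointness
  its axiom asks for. This and the next three lemmas use that to shed the
  \<open>disj_subsets\<close> premises.\<close>

lemma I_commute: "I A B C \<longleftrightarrow> I B A C"
  using domain symmetry by blast

lemma I_mono:
  assumes "I A B C" "B' \<subseteq> B"
  shows "I A B' C"
proof -
  have "disj_subsets V [A, B', C, B - B']"
    using domain[OF assms(1)] assms(2) by (auto simp: disj_subsets_3 disj_subsets_4)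
  moreover have "B' \<union> (B - B') = B"
    using assms(2) by blast
  ultimately show ?thesis
    using decomposition assms(1) by metis
qed

lemma I_weak_union:
  assumes "I A B C" "D \<subseteq> B"
  shows "I A (B - D) (C \<union> D)"
proof -
  have "disj_subsets V [A, B - D, C, D]"
    using domain[OF assms(1)] assms(2) by (auto simp: disj_subsets_3 disj_subsets_4)
  moreover have "(B - D) \<union> D = B"
    using assms(2) by blast
  ultimately show ?thesis
    using weak_union assms(1) by metis
qed

lemma I_contraction:
  assumes "I A B C" "I A D (B \<union> C)"
  shows "I A (B \<union> D) C"
proof -
  have "disj_subsets V [A, B, C, D]"
    using domain[OF assms(1)] domain[OF assms(2)] by (auto simp: disj_subsets_3 disj_subsets_4)
  then show ?thesis
    using contraction assms by blast
qed

text \<open>Given \<open>U \<inter> W\<close>, the intersection axiom merges the two differences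
  \<open>W - U\<close> and \<open>U - W\<close>. Contraction then adds the rest of \<open>S\<close>,
  which is independent of \<open>A\<close> given \<open>U \<union> W\<close>.\<close>

lemma blanket_Int:
  assumes U: "U \<subseteq> S" "I A (S - U) U" and W: "W \<subseteq> S" "I A (S - W) W"
  shows "I A (S - U \<inter> W) (U \<inter> W)"
proof -
  have "I A (W - U) U" "I A (U - W) W"
    using U W by (auto intro: I_mono)
  moreover have "(U - W) \<union> (U \<inter> W) = U" "(W - U) \<union> (U \<inter> W) = W"
    by auto
  moreover have "disj_subsets V [A, W - U, U - W, U \<inter> W]"
    using domain[OF U(2)] domain[OF W(2)] U(1) W(1)
    by (auto simp: disj_subsets_3 disj_subsets_4)
  ultimately have "I A ((W - U) \<union> (U - W)) (U \<inter> W)"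
    using intersection by metis
  \<comment> \<open>Weak union moves \<open>W - U\<close> from \<open>S - U\<close> into the
    condition \<open>U\<close>. What stays on the left is \<open>S - (U \<union> W)\<close>, and the
    condition \<open>U \<union> W\<close> is split to fit contraction.\<close>
  moreover have "I A ((S - U) - (W - U)) (((W - U) \<union> (U - W)) \<union> (U \<inter> W))"
  proof -
    have "I A ((S - U) - (W - U)) (U \<union> (W - U))"
      using W(1) by (intro I_weak_union[OF U(2)]) blast
    also have "U \<union> (W - U) = ((W - U) \<union> (U - W)) \<union> (U \<inter> W)"
      by auto
    finally show ?thesis .
  qed
  ultimately have "I A (((W - U) \<union> (U - W)) \<union> ((S - U) - (W - U))) (U \<inter> W)"
    by (rule I_contraction)
  moreover have "((W - U) \<union> (U - W)) \<union> ((S - U) - (W - U)) = S - U \<inter> W"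
    using U(1) W(1) by auto
  ultimately show ?thesis
    by simp
qed

text \<open>The blankets form a finite family closed under binary intersection, nonempty since
  \<open>S\<close> is one by triviality. Hence their intersection is again a blanket.\<close>

lemma markov_boundary_blanket:
  assumes "finite S" "j \<in> V" "S \<subseteq> V - {j}"
  shows "markov_boundary I j S \<subseteq> S" (is ?sub)
    and "I {j} (S - markov_boundary I j S) (markov_boundary I j S)" (is ?ind)
proof -
  let ?B = "{U. U \<subseteq> S \<and> I {j} (S - U) U}"
  have "I {j} (S - S) S"
    using I_empty[of "{j}" S] assms(2,3) by auto
  then have "?B \<noteq> {}"
    by blast
  moreover have "finite ?B"
    using assms(1) by simp
  moreover have "U \<inter> W \<in> ?B" if "U \<in> ?B" "W \<in> ?B" for U W
    using that blanket_Int by auto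
  ultimately have "\<Inter>?B \<in> ?B"
    by (intro finite_Inf_in)
  then show ?sub ?ind
    by (auto simp: markov_boundary_def)
qed

text \<open>Being a blanket is transitive by contraction: the boundary \<open>?n\<close> of
  \<open>?m\<close> is also a blanket in \<open>S\<close>, so minimality of \<open>?m\<close> gives
  \<open>?m \<subseteq> ?n\<close>.\<close>

lemma markov_boundary_idem:
  assumes "finite S" "j \<in> V" "S \<subseteq> V - {j}"
  shows "markov_boundary I j (markov_boundary I j S) = markov_boundary I j S"
    (is "?n = ?m")
proof
  note m = markov_boundary_blanket[OF assms]
  have n: "?n \<subseteq> ?m" "I {j} (?m - ?n) ?n"
    using markov_boundary_blanket[of ?m j] m(1) assms finite_subset by blast+
  show "?n \<subseteq> ?m"
    by (fact n(1))
  have "(?m - ?n) \<union> ?n = ?m"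
    using n(1) by blast
  then have "I {j} ((?m - ?n) \<union> (S - ?m)) ?n"
    using I_contraction[OF n(2)] m(2) by simp
  moreover have "(?m - ?n) \<union> (S - ?m) = S - ?n"
    using n(1) m(1) by blast
  ultimately show "?m \<subseteq> ?n"
    using n(1) m(1) by (metis markov_boundary_least order_trans)
qed

text \<open>For the converse, \<open>m\<close> is a blanket in \<open>T\<close>, so it contains the
  boundary \<open>?n\<close> of \<open>T\<close>. By decomposition \<open>?n\<close> is a blanket in
  \<open>m\<close>, and \<open>m\<close>, as its own boundary, has no smaller one.\<close>

lemma markov_boundary_eq_iff:
  assumes "j \<in> V" "finite T" "T \<subseteq> V - {j}" and m_fix: "markov_boundary I j m = m"
  shows "markov_boundary I j T = m \<longleftrightarrow> m \<subseteq> T \<and> I {j} (T - m) m"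
proof
  show "m \<subseteq> T \<and> I {j} (T - m) m" if "markov_boundary I j T = m"
    using markov_boundary_blanket[of T j] assms that by blast
next
  let ?n = "markov_boundary I j T"
  assume mT: "m \<subseteq> T \<and> I {j} (T - m) m"
  then have "?n \<subseteq> m"
    using mT by (simp add: markov_boundary_least)
  moreover have "I {j} (m - ?n) ?n"
    using mT markov_boundary_blanket(2)[of T j] assms(1-3) by (auto intro: I_mono)
  ultimately have "markov_boundary I j m \<subseteq> ?n"
    by (rule markov_boundary_least)
  with m_fix \<open>?n \<subseteq> m\<close> show "?n = m"
    by blast
qed

end

context compositional_graphoid
begin

text \<open>Replacing \<open>D\<close> by \<open>D - B\<close> makes composition applicable when
  \<open>B\<close> and \<open>D\<close> overlap.\<close>

lemma I_Un:
  assumes "I A B C" "I A D C"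
  shows "I A (B \<union> D) C"
proof -
  have "I A (D - B) C"
    using assms(2) by (rule I_mono) blast
  moreover have "disj_subsets V [A, B, C, D - B]"
    using domain[OF assms(1)] domain[OF assms(2)] by (auto simp: disj_subsets_3 disj_subsets_4)
  ultimately have "I A (B \<union> (D - B)) C"
    using composition assms(1) by blast
  then show ?thesis
    by simp
qed

lemma I_pointwise:
  assumes "finite B" "A \<subseteq> V" "C \<subseteq> V" "A \<inter> C = {}"
  shows "I A B C \<longleftrightarrow> (\<forall>k\<in>B. I A {k} C)"
proof
  show "\<forall>k\<in>B. I A {k} C" if "I A B C"
    using that by (auto intro: I_mono)
  show "I A B C" if "\<forall>k\<in>B. I A {k} C"
    using assms(1) that
  proof (induction B rule: finite_induct)
    case empty
    show ?case
      using assms by (simp add: I_empty)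
  next
    case (insert k B)
    then show ?case
      using I_Un[of A "{k}" C B] by simp
  qed
qed

lemma nbhd_lattice_eq_interval:
  assumes "finite V" "j \<in> V" "S \<subseteq> V - {j}"
  defines "m \<equiv> markov_boundary I j S"
  defines "M \<equiv> S \<union> {k \<in> (V - {j}) - S. I {k} {j} m}"
  shows "nbhd_lattice V I j S = {m..M}"
proof (rule set_eqI)
  fix T
  have fin: "finite T" if "T \<subseteq> V - {j}" for T
    using that assms(1) by (rule rev_finite_subset[OF finite_Diff, rotated])
  have m: "m \<subseteq> S" "I {j} (S - m) m" "markov_boundary I j m = m"
    unfolding m_def
    using markov_boundary_blanket[of S j] markov_boundary_idem[of S j] assms(2,3) fin[of S]
    by simp_all
  have pointwise: "I {j} (T - m) m \<longleftrightarrow> (\<forall>k\<in>T - m. I {k} {j} m)" if "T \<subseteq> V - {j}" for T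
    using I_pointwise[of "T - m" "{j}" m] fin[OF that] m(1) assms(2,3) I_commute by auto
  have "T \<in> nbhd_lattice V I j S \<longleftrightarrow> T \<subseteq> V - {j} \<and> m \<subseteq> T \<and> I {j} (T - m) m"
    using markov_boundary_eq_iff[OF assms(2) _ _ m(3)] fin
    by (auto simp: nbhd_lattice_def m_def)
  also have "\<dots> \<longleftrightarrow> T \<subseteq> V - {j} \<and> m \<subseteq> T \<and> (\<forall>k\<in>T - m. I {k} {j} m)"
    using pointwise by blast
  \<comment> \<open>Since \<open>m\<close> is a blanket in \<open>S\<close>, every point of
    \<open>S - m\<close> passes the test. Only points outside \<open>S\<close> are constrained, and
    those passing are exactly the ones that \<open>M\<close> adds to \<open>S\<close>.\<close>
  also have "\<dots> \<longleftrightarrow> T \<in> {m..M}"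
    using pointwise[of S] m(1,2) assms(3) unfolding M_def by auto
  finally show "T \<in> nbhd_lattice V I j S \<longleftrightarrow> T \<in> {m..M}" .
qed

end

lemma interval_imp_convex_sublattice:
  assumes "interval_in_Pow W \<C>"
  shows "convex_in_Pow W \<C>" "sublattice_of_Pow W \<C>"
proof -
  obtain A B where "A \<subseteq> B" "B \<subseteq> W" "\<C> = {A..B}"
    using assms by (auto simp: interval_in_Pow_def)
  then show "convex_in_Pow W \<C>" "sublattice_of_Pow W \<C>"
    by (auto simp: convex_in_Pow_def sublattice_of_Pow_def) blast+
qed

text \<open>The lattices are the nonempty fibres of \<open>markov_boundary I j\<close> on
  \<open>Pow (V - {j})\<close>.\<close>

lemma partition_on_nbhd_lattices:
  "partition_on (Pow (V - {j})) {nbhd_lattice V I j S | S. S \<subseteq> V - {j}}"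
  by (rule partition_onI) (auto simp: nbhd_lattice_def disjnt_def)

theorem theorem3p2:
  fixes V :: "'a set" and I :: "'a set \<Rightarrow> 'a set \<Rightarrow> 'a set \<Rightarrow> bool"
    and j :: 'a and S :: "'a set"
  assumes "finite V"
    and "compositional_graphoid V I"
    and "j \<in> V"
    and "S \<subseteq> V - {j}"
  shows
    "(interval_in_Pow (V - {j}) (nbhd_lattice V I j S)
           \<and> convex_in_Pow (V - {j}) (nbhd_lattice V I j S)
           \<and> sublattice_of_Pow (V - {j}) (nbhd_lattice V I j S))
      \<and> (\<Inter>(nbhd_lattice V I j S) = markov_boundary I j S)
      \<and> (\<Union>(nbhd_lattice V I j S)
           = S \<union> {k \<in> (V - {j}) - S. I {k} {j} (markov_boundary I j S)})
      \<and> (partition_on (Pow (V - {j})) {nbhd_lattice V I j S' | S'. S' \<subseteq> V - {j}}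
           \<and> nbhd_lattice V I j S = nbhd_lattice V I j (markov_boundary I j S)
           \<and> Pow (V - {j})
               = (\<Union>m\<in>{markov_boundary I j T | T. T \<subseteq> V - {j}}. nbhd_lattice V I j m)
           \<and> disjoint_family_on (nbhd_lattice V I j) {markov_boundary I j T | T. T \<subseteq> V - {j}})"
proof -
  interpret compositional_graphoid V I
    by fact
  let ?m = "markov_boundary I j" and ?L = "nbhd_lattice V I j"
  let ?M = "S \<union> {k \<in> (V - {j}) - S. I {k} {j} (?m S)}"
  have fin: "finite T" if "T \<subseteq> V - {j}" for T
    using that \<open>finite V\<close> finite_subset by blast
  have idem: "?m (?m T) = ?m T" if "T \<subseteq> V - {j}" for T
    using markov_boundary_idem[of T j] that fin[of T] \<open>j \<in> V\<close> by simp
  have sub: "?m T \<subseteq> T" if "T \<subseteq> V - {j}" for T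
    using markov_boundary_blanket(1)[of T j] that fin[of T] \<open>j \<in> V\<close> by simp
  have L: "?L S = {?m S..?M}"
    using nbhd_lattice_eq_interval[of j S] assms by simp
  have le: "?m S \<subseteq> ?M"
    using sub[OF assms(4)] by blast
  then have interval: "interval_in_Pow (V - {j}) (?L S)"
    using L assms(4) unfolding interval_in_Pow_def by blast
  have "\<Inter>(?L S) = ?m S" "\<Union>(?L S) = ?M"
    unfolding L using le by (auto 0 3)
  moreover have "?L S = ?L (?m S)"
    using idem[OF assms(4)] by (simp add: nbhd_lattice_def)
  moreover have "Pow (V - {j}) = (\<Union>m\<in>{?m T | T. T \<subseteq> V - {j}}. ?L m)"
  proof (intro subset_antisym subsetI)
    fix T assume "T \<in> Pow (V - {j})"
    \<comment> \<open>By idempotence \<open>T\<close> and \<open>?m T\<close> have the same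
      boundary, so they lie in the same fibre.\<close>
    then have "T \<in> ?L (?m T)"
      using idem by (simp add: nbhd_lattice_def)
    with \<open>T \<in> Pow (V - {j})\<close> show "T \<in> (\<Union>m\<in>{?m T | T. T \<subseteq> V - {j}}. ?L m)"
      by blast
  qed (auto simp: nbhd_lattice_def)
  \<comment> \<open>Each index is its own boundary, so a common member of two lattices forces their
    indices to agree.\<close>
  moreover have "disjoint_family_on ?L {?m T | T. T \<subseteq> V - {j}}"
    using idem by (auto simp: disjoint_family_on_def nbhd_lattice_def)
  ultimately show ?thesis
    using interval interval_imp_convex_sublattice[OF interval] partition_on_nbhd_lattices
    by (intro conjI)
qed

end
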